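(* Let $k\geq1$ and $d_1,\dots,d_k\geq3$ be integers and $T=W_{d_1}\otimes\cdots\otimes W_{d_k}$. Then $Z_k$ is the only zero-dimensional scheme evincing the cactus rank of $T$; that is, $Z_k$ is the unique zero-dimensional scheme $A\subseteq(\mathbb{P}^1)^k$ with $\deg(A)=c_{d_1,\dots,d_k}(T)$ and $[T]\in\langle\nu_{d_1,\dots,d_k}(A)\rangle$.
   Context: Identify $S^d\mathbb{C}^2$ with binary forms in a basis $\{x,y\}$; $W_d=x^{d-1}y$. $\nu_{d_1,\dots,d_k}:(\mathbb{P}^1)^k\to\mathbb{P}(S^{d_1}\mathbb{C}^2\otimes\cdots\otimes S^{d_k}\mathbb{C}^2)$, $([v_1],\dots,[v_k])\mapsto[v_1^{d_1}\otimes\cdots\otimes v_k^{d_k}]$, is the Segre–Veronese embedding; $\langle Y\rangle$ denotes linear span of a subscheme. The cactus rank $c_{d_1,\dots,d_k}(T)$ is the minimal degree of a zero-dimensional scheme $A\subseteq(\mathbb{P}^1)^k$ with $[T]\in\langle\nu_{d_1,\dots,d_k}(A)\rangle$. Let $o_1=[x]\in\mathbb{P}^1$, $Z_1\subseteq\mathbb{P}^1$ the degree-2 scheme supported at $o_1$ with ideal $(\partial_y^2)$, and $Z_k=Z_1\times\cdots\times Z_1$ (degree $2^k$). *)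

theory Defs
  imports "HOL-Library.Poly_Mapping" Complex_Main
begin

text \<open>
Coordinate ring of (P^1)^k: C[X_0,Y_0,...,X_{k-1},Y_{k-1}], variable (i,False) = X_i
(dual to x in the i-th factor), (i,True) = Y_i (dual to y).  The same polynomial type
also models the tensor space S^{d_1}C^2 (x) ... (x) S^{d_k}C^2 as the multidegree-d
component of C[x_0,y_0,...,x_{k-1},y_{k-1}] (variable (i,False) = x_i, (i,True) = y_i).
\<close>

type_synonym mono = "(nat \<times> bool) \<Rightarrow>\<^sub>0 nat"
type_synonym mpoly = "mono \<Rightarrow>\<^sub>0 complex"

definition mono_ok :: "nat \<Rightarrow> mono \<Rightarrow> bool" where
  "mono_ok k m \<longleftrightarrow> (\<forall>v \<in> Poly_Mapping.keys m. fst v < k)"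

definition Sring :: "nat \<Rightarrow> mpoly set" where
  "Sring k = {p. \<forall>m \<in> Poly_Mapping.keys p. mono_ok k m}"

definition pdeg :: "mono \<Rightarrow> nat \<Rightarrow> nat" where
  "pdeg m i = Poly_Mapping.lookup m (i, False) + Poly_Mapping.lookup m (i, True)"

definition has_mdeg :: "nat \<Rightarrow> (nat \<Rightarrow> nat) \<Rightarrow> mono \<Rightarrow> bool" where
  "has_mdeg k t m \<longleftrightarrow> mono_ok k m \<and> (\<forall>i<k. pdeg m i = t i)"

definition Sdeg :: "nat \<Rightarrow> (nat \<Rightarrow> nat) \<Rightarrow> mpoly set" where
  "Sdeg k t = {p. \<forall>m \<in> Poly_Mapping.keys p. has_mdeg k t m}"

definition comp :: "nat \<Rightarrow> (nat \<Rightarrow> nat) \<Rightarrow> mpoly \<Rightarrow> mpoly" where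
  "comp k t p = Abs_poly_mapping (\<lambda>m. Poly_Mapping.lookup p m when has_mdeg k t m)"

definition cmult :: "complex \<Rightarrow> mpoly \<Rightarrow> mpoly" where
  "cmult c p = Poly_Mapping.single 0 c * p"

definition is_ideal :: "nat \<Rightarrow> mpoly set \<Rightarrow> bool" where
  "is_ideal k I \<longleftrightarrow> I \<subseteq> Sring k \<and> 0 \<in> I \<and> (\<forall>p\<in>I. \<forall>q\<in>I. p + q \<in> I)
     \<and> (\<forall>p\<in>I. \<forall>q\<in>Sring k. q * p \<in> I)"

definition multihomogeneous :: "nat \<Rightarrow> mpoly set \<Rightarrow> bool" where
  "multihomogeneous k I \<longleftrightarrow> (\<forall>p\<in>I. \<forall>t. comp k t p \<in> I)"

text \<open>B^N, B = irrelevant ideal (X_0,Y_0)\<inter>...\<inter>(X_{k-1},Y_{k-1}), is generated by the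
monomials of multidegree (N,...,N)\<close>
definition saturation :: "nat \<Rightarrow> mpoly set \<Rightarrow> mpoly set" where
  "saturation k J = {f \<in> Sring k. \<exists>N. \<forall>m. has_mdeg k (\<lambda>_. N) m
        \<longrightarrow> Poly_Mapping.single m 1 * f \<in> J}"

definition saturated :: "nat \<Rightarrow> mpoly set \<Rightarrow> bool" where
  "saturated k I \<longleftrightarrow> saturation k I \<subseteq> I"

text \<open>Hilbert function: dim_C (S/I)_t, as the least size of a family in S_t spanning S_t modulo I\<close>
definition hilb :: "nat \<Rightarrow> mpoly set \<Rightarrow> (nat \<Rightarrow> nat) \<Rightarrow> nat" where
  "hilb k I t = (LEAST n. \<exists>gs. length gs = n \<and> set gs \<subseteq> Sdeg k t \<and>
      (\<forall>p \<in> Sdeg k t. \<exists>c. p - (\<Sum>j<n. cmult (c j) (gs ! j)) \<in> I))"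

text \<open>zero-dimensional subschemes of (P^1)^k = saturated multihomogeneous ideals whose
multigraded Hilbert polynomial is constant; the degree is that constant\<close>
definition zero_dim_scheme :: "nat \<Rightarrow> mpoly set \<Rightarrow> bool" where
  "zero_dim_scheme k I \<longleftrightarrow> is_ideal k I \<and> multihomogeneous k I \<and> saturated k I \<and>
     (\<exists>N n. \<forall>t. (\<forall>i<k. N \<le> t i) \<longrightarrow> hilb k I t = n)"

definition scheme_deg :: "nat \<Rightarrow> mpoly set \<Rightarrow> nat" where
  "scheme_deg k I = (THE n. \<exists>N. \<forall>t. (\<forall>i<k. N \<le> t i) \<longrightarrow> hilb k I t = n)"

definition mfact :: "mono \<Rightarrow> nat" where
  "mfact m = (\<Prod>v \<in> Poly_Mapping.keys m. fact (Poly_Mapping.lookup m v))"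

text \<open>apolarity pairing between multidegree-d forms f (linear forms on the tensor space) and
tensors T: f(\<partial>) T\<close>
definition apolar :: "mpoly \<Rightarrow> mpoly \<Rightarrow> complex" where
  "apolar f T = (\<Sum>m \<in> Poly_Mapping.keys f. Poly_Mapping.lookup f m * Poly_Mapping.lookup T m * of_nat (mfact m))"

text \<open>[T] lies in the linear span of nu_d(A): T is killed by every linear form whose pullback
under nu_d lies in the ideal of A, i.e. by (I_A)_d\<close>
definition in_span :: "nat \<Rightarrow> (nat \<Rightarrow> nat) \<Rightarrow> mpoly set \<Rightarrow> mpoly \<Rightarrow> bool" where
  "in_span k d I T \<longleftrightarrow> (\<forall>f \<in> I \<inter> Sdeg k d. apolar f T = 0)"

definition cactus_rank :: "nat \<Rightarrow> (nat \<Rightarrow> nat) \<Rightarrow> mpoly \<Rightarrow> nat" where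
  "cactus_rank k d T = (LEAST n. \<exists>I. zero_dim_scheme k I \<and> scheme_deg k I = n \<and> in_span k d I T)"

definition Wtensor :: "nat \<Rightarrow> (nat \<Rightarrow> nat) \<Rightarrow> mpoly" where
  "Wtensor k d = Poly_Mapping.single
     (\<Sum>i<k. Poly_Mapping.single (i, False) (d i - 1) + Poly_Mapping.single (i, True) 1) 1"

definition Ysq_ideal :: "nat \<Rightarrow> mpoly set" where
  "Ysq_ideal k = {p. \<exists>g. (\<forall>i<k. g i \<in> Sring k) \<and>
       p = (\<Sum>i<k. g i * Poly_Mapping.single (Poly_Mapping.single (i, True) 2) 1)}"

text \<open>ideal of Z_k = Z_1 x ... x Z_1, Z_1 = V(\<partial>_y^2) at o_1 = [x]\<close>
definition Zk :: "nat \<Rightarrow> mpoly set" where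
  "Zk k = saturation k (Ysq_ideal k)"

end

theory Submission
  imports Defs
begin

text \<open>
Let \<open>I\<close> be the ideal of a scheme whose span contains \<open>T\<close>.  A monomial of multidegree below
\<open>d\<close> without squares \<open>Y\<^sub>i\<^sup>2\<close> divides the monomial of \<open>T\<close>, so by apolarity it has coefficient 0 in
every form of \<open>I\<close>.  In multidegree \<open>(1,\<dots>,1)\<close> these are all monomials; hence \<open>I\<close> vanishes
there, and as the Hilbert function of a saturated ideal is monotone, the degree is at least
\<open>2\<^sup>k\<close>.  If equality holds, the Hilbert function is at most \<open>2\<^sup>k\<close> in the multidegree with 2 at
place \<open>i\<close> and 1 elsewhere, which is below \<open>d\<close> because \<open>d\<^sub>i \<ge> 3\<close>.  The \<open>2\<^sup>k\<close> monomials without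
squares are independent modulo \<open>I\<close>, so all multiples of \<open>Y\<^sub>i\<^sup>2\<close> in this multidegree lie in \<open>I\<close>,
and saturation gives \<open>Y\<^sub>i\<^sup>2 \<in> I\<close>.  Any further element of \<open>I\<close> would force the product of all
\<open>Y\<^sub>i\<close> into \<open>I\<close>, against the vanishing in multidegree \<open>(1,\<dots>,1)\<close>.
\<close>

abbreviation lookup :: "('a \<Rightarrow>\<^sub>0 'b::zero) \<Rightarrow> 'a \<Rightarrow> 'b" where
  "lookup \<equiv> Poly_Mapping.lookup"

abbreviation keys :: "('a \<Rightarrow>\<^sub>0 'b::zero) \<Rightarrow> 'a set" where
  "keys \<equiv> Poly_Mapping.keys"

abbreviation mon :: "mono \<Rightarrow> mpoly" where
  "mon m \<equiv> Poly_Mapping.single m 1"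

abbreviation X :: "nat \<Rightarrow> mpoly" where
  "X i \<equiv> mon (Poly_Mapping.single (i, False) 1)"

abbreviation Y :: "nat \<Rightarrow> mpoly" where
  "Y i \<equiv> mon (Poly_Mapping.single (i, True) 1)"

subsection \<open>Polynomials\<close>

lemma lookup_mon_mult: "lookup (mon m * f) (m + m') = lookup f m'"
  by (simp add: lookup_mult lookup_single when_mult)

lemma add_diff_mono:
  fixes m n :: "'a \<Rightarrow>\<^sub>0 nat"
  assumes "\<And>v. lookup m v \<le> lookup n v"
  shows "m + (n - m) = n"
  by (rule poly_mapping_eqI) (simp add: lookup_add lookup_minus assms)

lemma keys_mon_mult: "keys (mon m * f) = (+) m ` keys f"
proof
  show "keys (mon m * f) \<subseteq> (+) m ` keys f"
    using keys_mult[of "mon m" f] by auto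
  show "(+) m ` keys f \<subseteq> keys (mon m * f)"
    by (auto simp: in_keys_iff lookup_mon_mult)
qed

lemma mono_ok_add: "mono_ok k (m + n) \<longleftrightarrow> mono_ok k m \<and> mono_ok k n"
proof -
  have "keys (m + n) = keys m \<union> keys n"
    unfolding set_eq_iff Un_iff in_keys_iff lookup_add by simp
  then show ?thesis
    by (auto simp: mono_ok_def)
qed

lemma pdeg_add [simp]: "pdeg (m + n) i = pdeg m i + pdeg n i"
  by (simp add: pdeg_def lookup_add)

lemma has_mdeg_add:
  "has_mdeg k s m \<Longrightarrow> has_mdeg k t n \<Longrightarrow> has_mdeg k (\<lambda>i. s i + t i) (m + n)"
  by (auto simp: has_mdeg_def mono_ok_add)

lemma has_mdeg_pdeg: "mono_ok k m \<Longrightarrow> has_mdeg k (pdeg m) m"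
  by (simp add: has_mdeg_def)

lemma lookup_cmult [simp]: "lookup (cmult c p) m = c * lookup p m"
  unfolding cmult_def by (simp add: lookup_mult lookup_single when_mult)

lemma cmult_zero [simp]: "cmult 0 p = 0" "cmult c 0 = 0"
  by (simp_all add: cmult_def)

lemma mult_cmult: "p * cmult c q = cmult c (p * q)"
  by (simp add: cmult_def ac_simps)

lemma cmult_cmult: "cmult a (cmult b p) = cmult (a * b) p"
  by (rule poly_mapping_eqI) simp

lemma cmult_one [simp]: "cmult 1 p = p"
  by (simp add: cmult_def)

lemma cmult_sum: "cmult c (\<Sum>j\<in>J. g j) = (\<Sum>j\<in>J. cmult c (g j))"
  by (simp add: cmult_def sum_distrib_left)

lemma cmult_sum_left: "cmult (\<Sum>j\<in>J. c j) p = (\<Sum>j\<in>J. cmult (c j) p)"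
  by (rule poly_mapping_eqI) (simp add: lookup_sum sum_distrib_right)

lemma lookup_comp: "lookup (comp k t p) m = (lookup p m when has_mdeg k t m)"
proof -
  have "finite {m. (lookup p m when has_mdeg k t m) \<noteq> 0}"
    by (rule finite_subset[OF _ finite_keys[of p]]) (auto simp: in_keys_iff)
  then show ?thesis
    by (simp add: comp_def)
qed

lemma comp_in_Sdeg: "comp k t p \<in> Sdeg k t"
  by (auto simp: Sdeg_def in_keys_iff lookup_comp when_def split: if_splits)

text \<open>An exponent is at most the degree of its factor. Bounding all of them by
  \<open>sum t {..<k}\<close> gives one finite range for every variable, so only finitely many
  functions with default value 0 are possible.\<close>

lemma finite_has_mdeg: "finite {m. has_mdeg k t m}"
proof -
  let ?A = "{..<k} \<times> (UNIV :: bool set)" and ?B = "{..sum t {..<k}}"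
  have "lookup ` {m. has_mdeg k t m}
      \<subseteq> {f. \<forall>v. (v \<in> ?A \<longrightarrow> f v \<in> ?B) \<and> (v \<notin> ?A \<longrightarrow> f v = 0)}"
  proof clarify
    fix m v
    assume m: "has_mdeg k t m"
    have out: "lookup m v = 0" if "\<not> fst v < k"
      using m that by (auto simp: has_mdeg_def mono_ok_def in_keys_iff)
    have "lookup m v \<le> sum t {..<k}" if "fst v < k"
    proof -
      have "lookup m v \<le> pdeg m (fst v)"
        by (cases v; cases "snd v") (auto simp: pdeg_def)
      also have "\<dots> = t (fst v)"
        using m that by (simp add: has_mdeg_def)
      also have "\<dots> \<le> sum t {..<k}"
        using that by (intro member_le_sum) auto
      finally show ?thesis .
    qed
    with out show "(v \<in> ?A \<longrightarrow> lookup m v \<in> ?B) \<and> (v \<notin> ?A \<longrightarrow> lookup m v = 0)"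
      by (auto simp: mem_Times_iff)
  qed
  then have "finite (lookup ` {m. has_mdeg k t m})"
    by (rule finite_subset) (intro finite_set_of_finite_funs; simp)
  moreover have "inj_on lookup {m. has_mdeg k t m}"
    by (simp add: inj_on_def)
  ultimately show ?thesis
    by (rule finite_imageD)
qed

lemma lookup_sum_mon:
  assumes "finite M"
  shows "lookup (\<Sum>m\<in>M. cmult (c m) (mon m)) n = (if n \<in> M then c n else 0)"
proof -
  have "lookup (\<Sum>m\<in>M. cmult (c m) (mon m)) n = (\<Sum>m\<in>M. if m = n then c m else 0)"
    unfolding lookup_sum by (rule sum.cong) (auto simp: lookup_single when_def)
  then show ?thesis
    using assms by simp
qed

lemma Sdeg_sum_mon:
  assumes "p \<in> Sdeg k t"
  shows "p = (\<Sum>m\<in>{m. has_mdeg k t m}. cmult (lookup p m) (mon m))"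
  using assms
  by (intro poly_mapping_eqI)
     (auto simp: lookup_sum_mon[OF finite_has_mdeg] Sdeg_def in_keys_iff)

section \<open>Membership in the graded pieces and in the coordinate ring\<close>

lemma Sdeg_iff: "p \<in> Sdeg k t \<longleftrightarrow> (\<forall>m. lookup p m \<noteq> 0 \<longrightarrow> has_mdeg k t m)"
  by (auto simp: Sdeg_def in_keys_iff)

lemma Sring_iff: "p \<in> Sring k \<longleftrightarrow> (\<forall>m. lookup p m \<noteq> 0 \<longrightarrow> mono_ok k m)"
  by (auto simp: Sring_def in_keys_iff)

lemma Sdeg_subset_Sring: "Sdeg k t \<subseteq> Sring k"
  by (auto simp: Sdeg_def Sring_def has_mdeg_def)

lemma mon_in_Sdeg [simp]: "mon m \<in> Sdeg k t \<longleftrightarrow> has_mdeg k t m"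
  by (simp add: Sdeg_def)

lemma mon_in_Sring [simp]: "mon m \<in> Sring k \<longleftrightarrow> mono_ok k m"
  by (simp add: Sring_def)

lemma cmult_in_Sdeg: "p \<in> Sdeg k t \<Longrightarrow> cmult c p \<in> Sdeg k t"
  by (simp add: Sdeg_iff)

lemma add_in_Sdeg: "p \<in> Sdeg k t \<Longrightarrow> q \<in> Sdeg k t \<Longrightarrow> p + q \<in> Sdeg k t"
  unfolding Sdeg_iff lookup_add by (metis add_0)

lemma sum_in_Sdeg: "(\<And>j. j \<in> J \<Longrightarrow> g j \<in> Sdeg k t) \<Longrightarrow> (\<Sum>j\<in>J. g j) \<in> Sdeg k t"
  by (induction J rule: infinite_finite_induct) (auto simp: add_in_Sdeg, simp_all add: Sdeg_def)

lemma mult_in_Sdeg: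
  assumes "p \<in> Sdeg k s" "q \<in> Sdeg k t"
  shows "p * q \<in> Sdeg k (\<lambda>i. s i + t i)"
  using assms keys_mult[of p q] has_mdeg_add unfolding Sdeg_def by blast

lemma mult_in_Sring: "p \<in> Sring k \<Longrightarrow> q \<in> Sring k \<Longrightarrow> p * q \<in> Sring k"
  using keys_mult[of p q] mono_ok_add unfolding Sring_def by blast

lemma single_0_in_Sring: "Poly_Mapping.single 0 c \<in> Sring k"
  by (auto simp: Sring_def mono_ok_def)

lemma mono_ok_single [simp]: "i < k \<Longrightarrow> mono_ok k (Poly_Mapping.single (i, b) n)"
  by (auto simp: mono_ok_def)

lemma has_mdeg_single:
  "i < k \<Longrightarrow> has_mdeg k ((\<lambda>_. 0)(i := n)) (Poly_Mapping.single (i, b) n)"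
  by (cases b) (auto simp: has_mdeg_def pdeg_def lookup_single when_def)

subsection \<open>Ideals\<close>

lemma is_idealD:
  assumes "is_ideal k I"
  shows "I \<subseteq> Sring k" "0 \<in> I" "\<And>p q. p \<in> I \<Longrightarrow> q \<in> I \<Longrightarrow> p + q \<in> I"
    "\<And>p q. p \<in> I \<Longrightarrow> q \<in> Sring k \<Longrightarrow> q * p \<in> I"
  using assms unfolding is_ideal_def by blast+

lemma ideal_cmult: "is_ideal k I \<Longrightarrow> p \<in> I \<Longrightarrow> cmult c p \<in> I"
  unfolding cmult_def by (rule is_idealD(4)[OF _ _ single_0_in_Sring])

lemma ideal_cmult_iff:
  assumes "is_ideal k I" "c \<noteq> 0"
  shows "cmult c p \<in> I \<longleftrightarrow> p \<in> I"
  using ideal_cmult[OF assms(1), of "cmult c p" "inverse c"] ideal_cmult[OF assms(1), of p c] assms(2)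
  by (auto simp: cmult_cmult)

lemma ideal_diff:
  assumes "is_ideal k I" "p \<in> I" "q \<in> I"
  shows "p - q \<in> I"
proof -
  have "cmult (-1) q = - q"
    by (rule poly_mapping_eqI) simp
  then show ?thesis
    using is_idealD(3)[OF assms(1,2) ideal_cmult[OF assms(1,3), of "-1"]] by simp
qed

lemma ideal_sum:
  "is_ideal k I \<Longrightarrow> (\<And>j. j \<in> J \<Longrightarrow> g j \<in> I) \<Longrightarrow> (\<Sum>j\<in>J. g j) \<in> I"
  by (induction J rule: infinite_finite_induct) (auto simp: is_idealD)

lemma saturatedI:
  assumes "saturated k I" "f \<in> Sring k"
    and "\<And>m. has_mdeg k (\<lambda>_. N) m \<Longrightarrow> mon m * f \<in> I"
  shows "f \<in> I"
  using assms unfolding saturated_def saturation_def by blast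

text \<open>A monomial of multidegree (1,...,1) contains \<open>X i\<close> or \<open>Y i\<close>,
  so it carries \<open>f\<close> into \<open>I\<close>. Thus saturation can be used in one factor at
  a time.\<close>

lemma saturated_factor:
  assumes I: "is_ideal k I" "saturated k I" and f: "f \<in> Sring k" and "i < k"
    and "X i * f \<in> I" "Y i * f \<in> I"
  shows "f \<in> I"
proof (rule saturatedI[OF I(2) f, of 1])
  fix m
  assume m: "has_mdeg k (\<lambda>_. 1) m"
  have "pdeg m i = 1"
    using m \<open>i < k\<close> by (simp add: has_mdeg_def)
  then obtain b where b: "lookup m (i, b) = 1"
    unfolding pdeg_def by (metis add_is_1 One_nat_def)
  let ?v = "Poly_Mapping.single (i, b) (1::nat)"
  have eq: "?v + (m - ?v) = m"
    using b by (intro add_diff_mono) (auto simp: lookup_single when_def)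
  have "mono_ok k (m - ?v)"
    using m mono_ok_add[of k ?v "m - ?v"] unfolding eq has_mdeg_def by blast
  moreover have "mon ?v * f \<in> I"
    using assms(5,6) by (cases b) auto
  ultimately have "mon (m - ?v) * (mon ?v * f) \<in> I"
    using is_idealD(4)[OF I(1)] mon_in_Sring by blast
  moreover have "mon (m - ?v) * (mon ?v * f) = mon m * f"
    by (metis (no_types, lifting) eq mult_single mult.assoc mult.commute mult_1)
  ultimately show "mon m * f \<in> I"
    by simp
qed

subsection \<open>Linear independence modulo an ideal\<close>

text \<open>Stated for an indexed family, so that modulo an ideal a repeated member counts as a
  dependence.\<close>

definition indep_mod :: "mpoly set \<Rightarrow> 'i set \<Rightarrow> ('i \<Rightarrow> mpoly) \<Rightarrow> bool" where
  "indep_mod I J g \<longleftrightarrow> (\<forall>c. (\<Sum>j\<in>J. cmult (c j) (g j)) \<in> I \<longrightarrow> (\<forall>j\<in>J. c j = 0))"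

text \<open>Gaussian elimination on the last equation: either it is void, or some unknown
  \<open>p\<close> occurs in it and is eliminated from the other equations.\<close>

lemma homogeneous_system_nontrivial:
  fixes a :: "'i \<Rightarrow> nat \<Rightarrow> 'f::field"
  assumes "finite J" "n < card J"
  shows "\<exists>c. (\<exists>j\<in>J. c j \<noteq> 0) \<and> (\<forall>l<n. (\<Sum>j\<in>J. c j * a j l) = 0)"
  using assms
proof (induction n arbitrary: J a)
  case 0
  then have "J \<noteq> {}" by auto
  then show ?case
    by (intro exI[of _ "\<lambda>_. 1"]) auto
next
  case (Suc n)
  show ?case
  proof (cases "\<forall>j\<in>J. a j n = 0")
    case True
    obtain c where "\<exists>j\<in>J. c j \<noteq> 0" "\<forall>l<n. (\<Sum>j\<in>J. c j * a j l) = 0"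
      using Suc.IH[of J a] Suc.prems by auto
    with True show ?thesis
      by (intro exI[of _ c]) (auto simp: less_Suc_eq)
  next
    case False
    then obtain p where p: "p \<in> J" "a p n \<noteq> 0" by blast
    let ?J = "J - {p}"
    define b where "b j l = a j l - a j n / a p n * a p l" for j l
    obtain c where c: "\<exists>j\<in>?J. c j \<noteq> 0" "\<forall>l<n. (\<Sum>j\<in>?J. c j * b j l) = 0"
      using Suc.IH[of ?J b] Suc.prems p less_diff_conv by (auto simp: card_Diff_singleton)
    \<comment> \<open>Back substitution: the value at \<open>p\<close> is the one that solves
      equation \<open>n\<close>.\<close>
    define e where "e = c(p := - (\<Sum>j\<in>?J. c j * a j n / a p n))"
    have "(\<Sum>j\<in>J. e j * a j l) = (\<Sum>j\<in>?J. c j * b j l)" for l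
    proof -
      have "(\<Sum>j\<in>J. e j * a j l) = e p * a p l + (\<Sum>j\<in>?J. e j * a j l)"
        by (rule sum.remove[OF Suc.prems(1) p(1)])
      also have "(\<Sum>j\<in>?J. e j * a j l) = (\<Sum>j\<in>?J. c j * a j l)"
        by (rule sum.cong) (auto simp: e_def)
      also have "e p * a p l = - (\<Sum>j\<in>?J. c j * (a j n / a p n * a p l))"
        by (simp add: e_def sum_distrib_right mult.assoc)
      finally show ?thesis
        by (simp add: b_def algebra_simps sum_subtractf)
    qed
    moreover have "b j n = 0" for j
      using p by (simp add: b_def)
    ultimately have "\<forall>l<Suc n. (\<Sum>j\<in>J. e j * a j l) = 0"
      using c(2) by (auto simp: less_Suc_eq)
    moreover have "\<exists>j\<in>J. e j \<noteq> 0"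
      using c(1) by (auto simp: e_def)
    ultimately show ?thesis by blast
  qed
qed

lemma hilb_le_card:
  assumes "finite J" and g: "\<And>j. j \<in> J \<Longrightarrow> g j \<in> Sdeg k t"
    and span: "\<And>p. p \<in> Sdeg k t \<Longrightarrow> \<exists>c. p - (\<Sum>j\<in>J. cmult (c j) (g j)) \<in> I"
  shows "hilb k I t \<le> card J"
proof -
  obtain h where h: "bij_betw h {..<card J} J"
    using ex_bij_betw_nat_finite[OF assms(1)] by (auto simp: atLeast0LessThan)
  let ?gs = "map (\<lambda>n. g (h n)) [0..<card J]"
  have "\<exists>c. p - (\<Sum>j<card J. cmult (c j) (?gs ! j)) \<in> I" if p: "p \<in> Sdeg k t" for p
  proof -
    obtain c where c: "p - (\<Sum>j\<in>J. cmult (c j) (g j)) \<in> I"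
      using span[OF p] by blast
    have "(\<Sum>j<card J. cmult (c (h j)) (?gs ! j)) = (\<Sum>j<card J. cmult (c (h j)) (g (h j)))"
      by (rule sum.cong) auto
    also have "\<dots> = (\<Sum>j\<in>J. cmult (c j) (g j))"
      by (rule sum.reindex_bij_betw[OF h])
    finally show ?thesis
      using c by (intro exI[of _ "\<lambda>j. c (h j)"]) simp
  qed
  moreover have "set ?gs \<subseteq> Sdeg k t"
    using bij_betwE[OF h] g by auto
  ultimately show ?thesis
    unfolding hilb_def by (intro Least_le exI[of _ ?gs]) simp
qed

text \<open>The minimum in \<open>hilb\<close> is attained because some finite spanning list exists,
  namely all monomials of multidegree \<open>t\<close>.\<close>

lemma hilb_spanning:
  assumes "is_ideal k I"
  obtains g where "\<And>j. j < hilb k I t \<Longrightarrow> g j \<in> Sdeg k t"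
    "\<And>p. p \<in> Sdeg k t \<Longrightarrow> \<exists>c. p - (\<Sum>j<hilb k I t. cmult (c j) (g j)) \<in> I"
proof -
  let ?P = "\<lambda>n. \<exists>gs. length gs = n \<and> set gs \<subseteq> Sdeg k t \<and>
      (\<forall>p \<in> Sdeg k t. \<exists>c. p - (\<Sum>j<n. cmult (c j) (gs ! j)) \<in> I)"
  let ?M = "{m. has_mdeg k t m}"
  obtain h where h: "bij_betw h {..<card ?M} ?M"
    using ex_bij_betw_nat_finite[OF finite_has_mdeg] by (auto simp: atLeast0LessThan)
  let ?gs = "map (\<lambda>n. mon (h n)) [0..<card ?M]"
  have "\<exists>c. p - (\<Sum>j<card ?M. cmult (c j) (?gs ! j)) \<in> I" if "p \<in> Sdeg k t" for p
  proof -
    have "(\<Sum>j<card ?M. cmult (lookup p (h j)) (?gs ! j))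
        = (\<Sum>j<card ?M. cmult (lookup p (h j)) (mon (h j)))"
      by (rule sum.cong) auto
    also have "\<dots> = (\<Sum>m\<in>?M. cmult (lookup p m) (mon m))"
      by (rule sum.reindex_bij_betw[OF h])
    also have "\<dots> = p"
      by (rule Sdeg_sum_mon[OF that, symmetric])
    finally show ?thesis
      using is_idealD(2)[OF assms] by (intro exI[of _ "\<lambda>j. lookup p (h j)"]) simp
  qed
  moreover have "set ?gs \<subseteq> Sdeg k t"
    using h by (auto simp: bij_betw_def)
  ultimately have "?P (card ?M)"
    by (intro exI[of _ ?gs]) simp
  then have "?P (hilb k I t)"
    unfolding hilb_def by (rule LeastI)
  then obtain gs where "length gs = hilb k I t" "set gs \<subseteq> Sdeg k t"
    "\<forall>p \<in> Sdeg k t. \<exists>c. p - (\<Sum>j<hilb k I t. cmult (c j) (gs ! j)) \<in> I"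
    by blast
  then show ?thesis
    by (intro that[of "(!) gs"]) (auto simp: subset_iff)
qed

text \<open>Exchange argument: the coordinates of the \<open>g j\<close> in a spanning family of
  length \<open>n\<close> satisfy a nontrivial relation as soon as there are more than
  \<open>n\<close> of them, and this relation puts a combination of the \<open>g j\<close> into
  \<open>I\<close>.\<close>

lemma indep_card_le_hilb:
  assumes I: "is_ideal k I" and "finite J" and g: "\<And>j. j \<in> J \<Longrightarrow> g j \<in> Sdeg k t"
    and indep: "indep_mod I J g"
  shows "card J \<le> hilb k I t"
proof (rule ccontr)
  define n where "n = hilb k I t"
  assume "\<not> card J \<le> hilb k I t"
  then have less: "n < card J" by (simp add: n_def)
  obtain h where h: "\<And>p. p \<in> Sdeg k t \<Longrightarrow> \<exists>c. p - (\<Sum>l<n. cmult (c l) (h l)) \<in> I"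
    using hilb_spanning[OF I] unfolding n_def by metis
  obtain a where a: "\<And>j. j \<in> J \<Longrightarrow> g j - (\<Sum>l<n. cmult (a j l) (h l)) \<in> I"
    using h[OF g] by metis
  obtain c where c: "\<exists>j\<in>J. c j \<noteq> 0" "\<forall>l<n. (\<Sum>j\<in>J. c j * a j l) = 0"
    using homogeneous_system_nontrivial[OF \<open>finite J\<close> less] by blast
  have "(\<Sum>j\<in>J. cmult (c j) (\<Sum>l<n. cmult (a j l) (h l)))
      = (\<Sum>l<n. cmult (\<Sum>j\<in>J. c j * a j l) (h l))"
    unfolding cmult_sum cmult_cmult cmult_sum_left by (rule sum.swap)
  also have "\<dots> = 0"
    using c(2) by simp
  finally have "(\<Sum>j\<in>J. cmult (c j) (g j))
      = (\<Sum>j\<in>J. cmult (c j) (g j - (\<Sum>l<n. cmult (a j l) (h l))))"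
    by (simp add: cmult_def right_diff_distrib sum_subtractf)
  also have "\<dots> \<in> I"
    by (intro ideal_sum[OF I] ideal_cmult[OF I] a)
  finally show False
    using indep c(1) unfolding indep_mod_def by blast
qed

text \<open>A spanning family of minimal length is independent, since a relation with
  \<open>c p \<noteq> 0\<close> would allow member \<open>p\<close> to be dropped.\<close>

lemma ex_indep_hilb:
  assumes I: "is_ideal k I"
  obtains g where "\<And>j. j < hilb k I t \<Longrightarrow> g j \<in> Sdeg k t" "indep_mod I {..<hilb k I t} g"
proof -
  define n where "n = hilb k I t"
  obtain g where g: "\<And>j. j < n \<Longrightarrow> g j \<in> Sdeg k t"
    and span: "\<And>p. p \<in> Sdeg k t \<Longrightarrow> \<exists>c. p - (\<Sum>j<n. cmult (c j) (g j)) \<in> I"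
    using hilb_spanning[OF I] unfolding n_def by metis
  have "indep_mod I {..<n} g"
    unfolding indep_mod_def
  proof (intro allI impI ballI, rule ccontr)
    fix c p
    assume c: "(\<Sum>j<n. cmult (c j) (g j)) \<in> I" and p: "p \<in> {..<n}" "c p \<noteq> 0"
    have "hilb k I t \<le> card ({..<n} - {p})"
    proof (rule hilb_le_card)
      fix q assume "q \<in> Sdeg k t"
      then obtain e where e: "q - (\<Sum>j<n. cmult (e j) (g j)) \<in> I"
        using span by blast
      \<comment> \<open>This multiple of the relation makes the coefficient \<open>?f p\<close>
        vanish.\<close>
      let ?r = "e p / c p"
      let ?f = "\<lambda>j. e j - ?r * c j"
      have "(\<Sum>j<n. cmult (e j) (g j)) - cmult ?r (\<Sum>j<n. cmult (c j) (g j))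
          = (\<Sum>j<n. cmult (?f j) (g j))"
        by (rule poly_mapping_eqI)
           (simp add: lookup_minus lookup_sum sum_distrib_left algebra_simps sum_subtractf)
      also have "\<dots> = (\<Sum>j\<in>{..<n} - {p}. cmult (?f j) (g j))"
        using p by (subst sum.remove[of _ p]) auto
      finally have "q - (\<Sum>j\<in>{..<n} - {p}. cmult (?f j) (g j))
          = (q - (\<Sum>j<n. cmult (e j) (g j))) + cmult ?r (\<Sum>j<n. cmult (c j) (g j))"
        by (simp add: algebra_simps)
      also have "\<dots> \<in> I"
        by (intro is_idealD(3)[OF I] e ideal_cmult[OF I] c)
      finally show "\<exists>f. q - (\<Sum>j\<in>{..<n} - {p}. cmult (f j) (g j)) \<in> I"
        by (rule exI[of _ ?f])
    qed (use g in auto)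
    with p show False
      by (simp add: n_def)
  qed
  with g show ?thesis
    by (intro that[of g]) (auto simp: n_def)
qed

subsection \<open>Monotonicity of the Hilbert function\<close>

text \<open>Any two of these forms with distinct \<open>c\<close> generate the same ideal as
  \<open>X i\<close> and \<open>Y i\<close>, and there are infinitely many of them.\<close>

definition lin :: "nat \<Rightarrow> complex \<Rightarrow> mpoly" where
  "lin i c = X i + cmult c (Y i)"

lemma lin_in_Sdeg: "i < k \<Longrightarrow> lin i c \<in> Sdeg k ((\<lambda>_. 0)(i := 1))"
  unfolding lin_def by (intro add_in_Sdeg cmult_in_Sdeg) (simp_all only: mon_in_Sdeg has_mdeg_single)

lemma lin_in_Sring: "i < k \<Longrightarrow> lin i c \<in> Sring k"
  using lin_in_Sdeg Sdeg_subset_Sring by blast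

lemma prod_in_Sring: "(\<And>j. j \<in> J \<Longrightarrow> g j \<in> Sring k) \<Longrightarrow> (\<Prod>j\<in>J. g j) \<in> Sring k"
  by (induction J rule: infinite_finite_induct)
     (auto simp: mult_in_Sring, simp_all add: Sring_def mono_ok_def)

text \<open>If both products were in \<open>I\<close>, so would be \<open>X i * f\<close> and
  \<open>Y i * f\<close>, which are combinations of them; saturation in factor \<open>i\<close>
  would then give \<open>f \<in> I\<close>.\<close>

lemma lin_mult_notin:
  assumes I: "is_ideal k I" "saturated k I" and "i < k" "f \<in> Sring k" "f \<notin> I"
    and a: "lin i a * f \<in> I" and "a \<noteq> b"
  shows "lin i b * f \<notin> I"
proof
  assume b: "lin i b * f \<in> I"
  have "lin i b * f - lin i a * f = cmult (b - a) (Y i * f)"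
    by (simp add: lin_def cmult_def single_diff algebra_simps)
  then have "cmult (b - a) (Y i * f) \<in> I"
    using ideal_diff[OF I(1) b a] by simp
  then have Y: "Y i * f \<in> I"
    using \<open>a \<noteq> b\<close> by (simp add: ideal_cmult_iff[OF I(1)])
  have "lin i a * f - cmult a (Y i * f) = X i * f"
    by (simp add: lin_def cmult_def algebra_simps)
  then have "X i * f \<in> I"
    using ideal_diff[OF I(1) a ideal_cmult[OF I(1) Y]] by metis
  with Y saturated_factor[OF I] assms show False by blast
qed

text \<open>The kernels of the multiplications by \<open>lin i c\<close> on \<open>(S/I)_t\<close> are independent for
  distinct \<open>c\<close>, so some \<open>lin i c\<close> acts injectively because \<open>(S/I)_t\<close> has finite dimension.\<close>

lemma ex_injective_lin:
  assumes I: "is_ideal k I" "saturated k I" and i: "i < k"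
  shows "\<exists>c. \<forall>f\<in>Sdeg k t. lin i c * f \<in> I \<longrightarrow> f \<in> I"
proof (rule ccontr)
  assume "\<not> ?thesis"
  then have "\<forall>c. \<exists>f. f \<in> Sdeg k t \<and> lin i c * f \<in> I \<and> f \<notin> I"
    by blast
  from choice[OF this] obtain F
    where F: "\<And>c. F c \<in> Sdeg k t" "\<And>c. lin i c * F c \<in> I" "\<And>c. F c \<notin> I"
    by blast
  \<comment> \<open>One index more than the dimension of (S/I)_t, so that independence of this
    family is contradictory.\<close>
  let ?J = "{..hilb k I t}"
  let ?a = "of_nat :: nat \<Rightarrow> complex"
  let ?l = "\<lambda>j. lin i (?a j)"
  have Fr: "F c \<in> Sring k" for c
    using F(1) Sdeg_subset_Sring by blast
  \<comment> \<open>\<open>lin i (?a p)\<close> sends each partial product into \<open>I\<close>, so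
    by \<open>lin_mult_notin\<close> a form with another parameter cannot do so; the factors are
    added one by one.\<close>
  have notin: "(\<Prod>j\<in>L. ?l j) * F (?a p) \<notin> I" if "finite L" "p \<notin> L" for L p
    using that
  proof (induction L)
    case empty
    then show ?case using F(3) by simp
  next
    case (insert q L)
    let ?f = "(\<Prod>j\<in>L. ?l j) * F (?a p)"
    have P: "(\<Prod>j\<in>L. ?l j) \<in> Sring k"
      by (intro prod_in_Sring lin_in_Sring i)
    have "?l p * ?f = (\<Prod>j\<in>L. ?l j) * (?l p * F (?a p))"
      by (simp add: ac_simps)
    also have "\<dots> \<in> I"
      by (rule is_idealD(4)[OF I(1) F(2) P])
    finally have "?l q * ?f \<notin> I"
      using insert by (intro lin_mult_notin[OF I i]) (auto intro: mult_in_Sring P Fr)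
    then show ?case
      using insert by (simp add: ac_simps)
  qed
  have "indep_mod I ?J (\<lambda>j. F (?a j))"
    unfolding indep_mod_def
  proof (intro allI impI ballI, rule ccontr)
    fix c p
    assume c: "(\<Sum>j\<in>?J. cmult (c j) (F (?a j))) \<in> I" and p: "p \<in> ?J" "c p \<noteq> 0"
    let ?L = "?J - {p}"
    \<comment> \<open>Multiplying the relation by all forms except the one for \<open>p\<close>
      sends every term into \<open>I\<close> except the term of \<open>p\<close>.\<close>
    let ?P = "\<Prod>j\<in>?L. ?l j"
    have Pc: "?P * cmult (c j) (F (?a j)) \<in> I" if "j \<in> ?L" for j
    proof -
      have "?P = (\<Prod>j\<in>?L - {j}. ?l j) * ?l j"
        using that by (subst prod.remove[of _ j]) (auto simp: ac_simps)
      then have "?P * F (?a j) = (\<Prod>j\<in>?L - {j}. ?l j) * (?l j * F (?a j))"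
        by (simp add: ac_simps)
      also have "\<dots> \<in> I"
        by (intro is_idealD(4)[OF I(1) F(2)] prod_in_Sring lin_in_Sring i)
      finally show ?thesis
        by (simp add: mult_cmult ideal_cmult[OF I(1)])
    qed
    have "?P * (\<Sum>j\<in>?J. cmult (c j) (F (?a j)))
        = ?P * cmult (c p) (F (?a p)) + (\<Sum>j\<in>?L. ?P * cmult (c j) (F (?a j)))"
      using p by (subst sum.remove[of _ p]) (auto simp: distrib_left sum_distrib_left)
    then have "?P * cmult (c p) (F (?a p))
        = ?P * (\<Sum>j\<in>?J. cmult (c j) (F (?a j))) - (\<Sum>j\<in>?L. ?P * cmult (c j) (F (?a j)))"
      by (simp only: add_diff_cancel_right')
    also have "\<dots> \<in> I"
      by (intro ideal_diff[OF I(1)] is_idealD(4)[OF I(1) c] ideal_sum[OF I(1)] Pc prod_in_Sring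
          lin_in_Sring i)
    finally show False
      using notin[of ?L p] p by (simp add: mult_cmult ideal_cmult_iff[OF I(1)])
  qed
  then have "card ?J \<le> hilb k I t"
    by (rule indep_card_le_hilb[OF I(1) finite_atMost F(1)])
  then show False by simp
qed

lemma hilb_cong: 
  assumes eq: "\<And>i. i < k \<Longrightarrow> s i = t i" shows "hilb k I s = hilb k I t"
proof -
  have "has_mdeg k s m \<longleftrightarrow> has_mdeg k t m" for m
    unfolding has_mdeg_def using eq by simp
  then have *: "Sdeg k s = Sdeg k t"
    unfolding Sdeg_def by simp
  show ?thesis
    unfolding hilb_def * ..
qed

text \<open>An injective multiplication by a linear form in factor \<open>i\<close> maps an
  independent family of multidegree \<open>t\<close> to an independent family one degree
  higher.\<close>

lemma hilb_mono_step:
  assumes I: "is_ideal k I" "saturated k I" and i: "i < k"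
  shows "hilb k I t \<le> hilb k I (t(i := Suc (t i)))"
proof -
  let ?J = "{..<hilb k I t}"
  obtain c where c: "\<And>f. f \<in> Sdeg k t \<Longrightarrow> lin i c * f \<in> I \<Longrightarrow> f \<in> I"
    using ex_injective_lin[OF I i] by blast
  obtain g where g: "\<And>j. j \<in> ?J \<Longrightarrow> g j \<in> Sdeg k t" and ind: "indep_mod I ?J g"
    using ex_indep_hilb[OF I(1), of t] by auto
  have "indep_mod I ?J (\<lambda>j. lin i c * g j)"
    unfolding indep_mod_def
  proof (intro allI impI)
    fix e
    assume "(\<Sum>j\<in>?J. cmult (e j) (lin i c * g j)) \<in> I"
    then have "lin i c * (\<Sum>j\<in>?J. cmult (e j) (g j)) \<in> I"
      by (simp only: sum_distrib_left mult_cmult)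
    then have "(\<Sum>j\<in>?J. cmult (e j) (g j)) \<in> I"
      using c sum_in_Sdeg[of ?J "\<lambda>j. cmult (e j) (g j)", OF cmult_in_Sdeg[OF g]] by blast
    with ind show "\<forall>j\<in>?J. e j = 0"
      by (simp add: indep_mod_def)
  qed
  moreover have "(\<lambda>j. ((\<lambda>_. 0)(i := 1)) j + t j) = t(i := Suc (t i))"
    by (rule ext) simp
  then have "lin i c * g j \<in> Sdeg k (t(i := Suc (t i)))" if "j \<in> ?J" for j
    using mult_in_Sdeg[OF lin_in_Sdeg[OF i] g[OF that]] by metis
  ultimately have "card ?J \<le> hilb k I (t(i := Suc (t i)))"
    by (intro indep_card_le_hilb[OF I(1) finite_lessThan])
  then show ?thesis by simp
qed

lemma hilb_mono:
  assumes I: "is_ideal k I" "saturated k I" and le: "\<And>i. i < k \<Longrightarrow> s i \<le> t i"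
  shows "hilb k I s \<le> hilb k I t"
  using le
proof (induction "\<Sum>i<k. t i - s i" arbitrary: s rule: less_induct)
  case less
  show ?case
  proof (cases "\<forall>i<k. s i = t i")
    case True
    then show ?thesis using hilb_cong[of k s t] by simp
  next
    case False
    then obtain i where i: "i < k" "s i < t i"
      using less.prems by (meson le_neq_implies_less)
    let ?s = "s(i := Suc (s i))"
    have "(\<Sum>j<k. t j - ?s j) < (\<Sum>j<k. t j - s j)"
      using i by (intro sum_strict_mono_ex1) auto
    then have "hilb k I ?s \<le> hilb k I t"
      using less.hyps[of ?s] less.prems i by auto
    with hilb_mono_step[OF I i(1), of s] show ?thesis by simp
  qed
qed

subsection \<open>Monomials with square-free Y-part\<close>

text \<open>Monomials given by explicit exponents of the \<open>X i\<close> and the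
  \<open>Y i\<close>; the one of the tensor has exponents \<open>d i - 1\<close> and 1.\<close>

definition bimono :: "nat \<Rightarrow> (nat \<Rightarrow> nat) \<Rightarrow> (nat \<Rightarrow> nat) \<Rightarrow> mono" where
  "bimono k a b = (\<Sum>i<k. Poly_Mapping.single (i, False) (a i) + Poly_Mapping.single (i, True) (b i))"

lemma lookup_bimono:
  "lookup (bimono k a b) (i, c) = (if i < k then if c then b i else a i else 0)"
proof -
  have "lookup (bimono k a b) (i, c) = (\<Sum>j<k. if j = i then if c then b i else a i else 0)"
    unfolding bimono_def lookup_sum
    by (rule sum.cong) (auto simp: lookup_add lookup_single when_def)
  then show ?thesis
    by simp
qed

lemma mono_ok_bimono: "mono_ok k (bimono k a b)"
  by (auto simp: mono_ok_def in_keys_iff lookup_bimono split: if_splits)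

lemma pdeg_bimono: "i < k \<Longrightarrow> pdeg (bimono k a b) i = a i + b i"
  by (simp add: pdeg_def lookup_bimono)

lemma lookup_mono_ok: "mono_ok k m \<Longrightarrow> \<not> i < k \<Longrightarrow> lookup m (i, b) = 0"
  by (force simp: mono_ok_def in_keys_iff)

lemma has_mdeg_eqI:
  assumes m: "has_mdeg k t m" and n: "has_mdeg k t n"
    and eq: "\<And>i. i < k \<Longrightarrow> lookup m (i, True) = lookup n (i, True)"
  shows "m = n"
proof (rule poly_mapping_eqI)
  fix v :: "nat \<times> bool"
  obtain i b where v: "v = (i, b)" by fastforce
  show "lookup m v = lookup n v"
  proof (cases "i < k")
    case True
    then have "pdeg m i = pdeg n i"
      using m n by (simp add: has_mdeg_def)
    then show ?thesis
      using eq[OF True] by (cases b) (simp_all add: v pdeg_def)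
  next
    case False
    then show ?thesis
      using m n lookup_mono_ok[of k m i b] lookup_mono_ok[of k n i b] by (simp add: v has_mdeg_def)
  qed
qed

text \<open>The standard monomials of multidegree \<open>t\<close> for the ideal of the squares of
  the \<open>Y i\<close>.\<close>

definition red_mons :: "nat \<Rightarrow> (nat \<Rightarrow> nat) \<Rightarrow> mono set" where
  "red_mons k t = {m. has_mdeg k t m \<and> (\<forall>i<k. lookup m (i, True) \<le> 1)}"

lemma finite_red_mons: "finite (red_mons k t)"
  by (rule finite_subset[OF _ finite_has_mdeg[of k t]]) (auto simp: red_mons_def)

lemma red_monsD: "m \<in> red_mons k t \<Longrightarrow> has_mdeg k t m"
  "m \<in> red_mons k t \<Longrightarrow> i < k \<Longrightarrow> lookup m (i, True) \<le> 1"
  by (simp_all add: red_mons_def)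

text \<open>Within a fixed multidegree a standard monomial is determined by the set of
  \<open>i\<close> for which \<open>Y i\<close> occurs. Every set is possible because
  \<open>1 \<le> t i\<close> leaves room for \<open>Y i\<close>.\<close>

lemma card_red_mons:
  assumes "\<And>i. i < k \<Longrightarrow> 1 \<le> t i"
  shows "card (red_mons k t) = 2 ^ k"
proof -
  let ?e = "\<lambda>S i. if i \<in> S then 1 else (0::nat)"
  let ?f = "\<lambda>S. bimono k (\<lambda>i. t i - ?e S i) (?e S)"
  let ?g = "\<lambda>m. {i. i < k \<and> lookup m (i, True) = 1}"
  have f: "?f S \<in> red_mons k t" for S
    using assms
    by (auto simp: red_mons_def has_mdeg_def mono_ok_bimono pdeg_bimono lookup_bimono)
  have "bij_betw ?f (Pow {..<k}) (red_mons k t)"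
  proof (rule bij_betw_byWitness[where f' = ?g])
    show "\<forall>m\<in>red_mons k t. ?f (?g m) = m"
    proof
      fix m assume m: "m \<in> red_mons k t"
      show "?f (?g m) = m"
      proof (rule has_mdeg_eqI[OF red_monsD(1)[OF f] red_monsD(1)[OF m]])
        fix i assume "i < k"
        then show "lookup (?f (?g m)) (i, True) = lookup m (i, True)"
          using red_monsD(2)[OF m, of i] by (auto simp: lookup_bimono)
      qed
    qed
  qed (use f in \<open>auto simp: lookup_bimono split: if_splits\<close>)
  then have "card (red_mons k t) = card (Pow {..<k})"
    by (rule bij_betw_same_card[symmetric])
  then show ?thesis
    by (simp add: card_Pow)
qed

subsection \<open>The ideal of the scheme \<open>Z\<^sub>k\<close>\<close>

definition has_square :: "nat \<Rightarrow> mono \<Rightarrow> bool" where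
  "has_square k m \<longleftrightarrow> (\<exists>i<k. 2 \<le> lookup m (i, True))"

text \<open>Monomial description of \<open>Ysq_ideal\<close>: membership can be checked one monomial
  at a time, without choosing cofactors.\<close>

definition square_ideal :: "nat \<Rightarrow> mpoly set" where
  "square_ideal k = {f \<in> Sring k. \<forall>m\<in>keys f. has_square k m}"

lemma has_square_add: "has_square k n \<Longrightarrow> has_square k (m + n)"
  unfolding has_square_def lookup_add by (meson trans_le_add2)

lemma mult_square_ideal:
  assumes "p \<in> square_ideal k" "q \<in> Sring k"
  shows "q * p \<in> square_ideal k"
proof -
  have "has_square k m" if "m \<in> keys (q * p)" for m
  proof -
    from that obtain a b where "m = a + b" "b \<in> keys p"
      using keys_mult[of q p] by blast
    then show ?thesis
      using assms(1) has_square_add by (simp add: square_ideal_def)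
  qed
  then show ?thesis
    using assms mult_in_Sring by (simp add: square_ideal_def)
qed

lemma is_ideal_square_ideal: "is_ideal k (square_ideal k)"
  unfolding is_ideal_def
proof (intro conjI ballI)
  fix p q
  assume p: "p \<in> square_ideal k"
  {
    assume "q \<in> square_ideal k"
    with p show "p + q \<in> square_ideal k"
      using keys_add[of p q] unfolding square_ideal_def Sring_def by blast
  next
    assume "q \<in> Sring k"
    with p show "q * p \<in> square_ideal k"
      by (rule mult_square_ideal)
  }
qed (auto simp: square_ideal_def Sring_def)

text \<open>One test monomial suffices: the product of the \<open>N\<close>-th powers of the
  \<open>X i\<close> leaves all exponents of the \<open>Y i\<close> unchanged.\<close>

lemma saturated_square_ideal: "saturation k (square_ideal k) \<subseteq> square_ideal k"
proof
  fix f
  assume "f \<in> saturation k (square_ideal k)"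
  then obtain N where f: "f \<in> Sring k"
    and N: "\<And>m. has_mdeg k (\<lambda>_. N) m \<Longrightarrow> mon m * f \<in> square_ideal k"
    unfolding saturation_def by blast
  let ?m = "bimono k (\<lambda>_. N) (\<lambda>_. 0)"
  have "has_mdeg k (\<lambda>_. N) ?m"
    by (simp add: has_mdeg_def mono_ok_bimono pdeg_bimono)
  then have "has_square k (?m + n)" if "n \<in> keys f" for n
    using N[of ?m] that by (auto simp: square_ideal_def keys_mon_mult)
  moreover have "has_square k n" if "has_square k (?m + n)" for n
    using that unfolding has_square_def lookup_add lookup_bimono by auto
  ultimately show "f \<in> square_ideal k"
    using f by (auto simp: square_ideal_def)
qed

lemma poly_as_sum: "p = (\<Sum>m\<in>keys p. cmult (lookup p m) (mon m))"
  by (rule poly_mapping_eqI) (simp add: lookup_sum_mon in_keys_iff)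

lemma Ysq_ideal_eq: "Ysq_ideal k = square_ideal k"
proof (intro subset_antisym subsetI)
  fix p
  assume "p \<in> Ysq_ideal k"
  then obtain g where g: "\<And>i. i < k \<Longrightarrow> g i \<in> Sring k"
    and p: "p = (\<Sum>i<k. g i * mon (Poly_Mapping.single (i, True) 2))"
    unfolding Ysq_ideal_def by blast
  have "mon (Poly_Mapping.single (i, True) 2) \<in> square_ideal k" if "i < k" for i
    using that by (auto simp: square_ideal_def has_square_def lookup_single)
  then show "p \<in> square_ideal k"
    unfolding p using g by (intro ideal_sum[OF is_ideal_square_ideal] mult_square_ideal) auto
next
  fix p
  assume p: "p \<in> square_ideal k"
  then have "\<forall>m. \<exists>i. m \<in> keys p \<longrightarrow> i < k \<and> 2 \<le> lookup m (i, True)"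
    by (auto simp: square_ideal_def has_square_def)
  \<comment> \<open>\<open>s\<close> selects for each monomial one \<open>Y i\<close> whose square
    divides it; collecting the monomials by this choice gives the cofactors
    \<open>?g i\<close>.\<close>
  from choice[OF this] obtain s
    where s: "\<And>m. m \<in> keys p \<Longrightarrow> s m < k \<and> 2 \<le> lookup m (s m, True)"
    by blast
  let ?v = "\<lambda>i. Poly_Mapping.single (i, True) (2::nat)"
  let ?K = "\<lambda>i. {m \<in> keys p. s m = i}"
  let ?g = "\<lambda>i. \<Sum>m\<in>?K i. cmult (lookup p m) (mon (m - ?v i))"
  have eq: "?v (s m) + (m - ?v (s m)) = m" if "m \<in> keys p" for m
    using s[OF that] by (intro add_diff_mono) (auto simp: lookup_single when_def)
  have "?g i * mon (?v i) = (\<Sum>m\<in>?K i. cmult (lookup p m) (mon m))" for i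
    unfolding sum_distrib_right
  proof (rule sum.cong)
    fix m assume "m \<in> ?K i"
    then have "?v i + (m - ?v i) = m"
      using eq by auto
    then show "cmult (lookup p m) (mon (m - ?v i)) * mon (?v i) = cmult (lookup p m) (mon m)"
      unfolding cmult_def mult.assoc mult_single by (simp add: add.commute)
  qed simp
  then have "(\<Sum>i<k. ?g i * mon (?v i)) = (\<Sum>m\<in>keys p. cmult (lookup p m) (mon m))"
    using s by (simp only:) (rule sum.group; auto)
  then have p_eq: "p = (\<Sum>i<k. ?g i * mon (?v i))"
    by (simp only: poly_as_sum[of p, symmetric])
  have g: "?g i \<in> Sring k" if "i < k" for i
  proof -
    have ok: "mono_ok k (m - ?v i)" if "m \<in> ?K i" for m
      using that p eq mono_ok_add[of k "?v i" "m - ?v i"]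
      by (auto simp: square_ideal_def Sring_def)
    have "lookup (?g i) n = 0" if "\<not> mono_ok k n" for n
      unfolding lookup_sum
    proof (rule sum.neutral, rule ballI)
      fix m assume "m \<in> ?K i"
      then have "m - ?v i \<noteq> n"
        using ok that by blast
      then show "lookup (cmult (lookup p m) (mon (m - ?v i))) n = 0"
        by (simp add: lookup_single)
    qed
    then show ?thesis
      unfolding Sring_iff by blast
  qed
  show "p \<in> Ysq_ideal k"
    unfolding Ysq_ideal_def
    by (intro CollectI exI[of _ ?g] conjI allI impI g p_eq)
qed

lemma Zk_eq: "Zk k = square_ideal k"
proof
  show "Zk k \<subseteq> square_ideal k"
    using saturated_square_ideal by (simp add: Zk_def Ysq_ideal_eq)
  have "mon m * f \<in> square_ideal k" if "f \<in> square_ideal k" "has_mdeg k t m" for f m t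
    using that by (intro mult_square_ideal) (auto simp: has_mdeg_def)
  then show "square_ideal k \<subseteq> Zk k"
    unfolding Zk_def Ysq_ideal_eq saturation_def by (auto simp: square_ideal_def)
qed

lemma not_red_has_square:
  "has_mdeg k t m \<Longrightarrow> m \<notin> red_mons k t \<longleftrightarrow> has_square k m"
  by (auto simp: red_mons_def has_square_def not_le Suc_le_eq numeral_2_eq_2)

text \<open>The standard monomials form a basis: removing them from \<open>p\<close> leaves only
  monomials divisible by a square, while a polynomial in the ideal contains no standard
  monomial.\<close>

lemma hilb_Zk:
  assumes "\<And>i. i < k \<Longrightarrow> 1 \<le> t i"
  shows "hilb k (Zk k) t = 2 ^ k"
proof (rule antisym)
  let ?R = "red_mons k t"
  have "hilb k (Zk k) t \<le> card ?R"
  proof (rule hilb_le_card[OF finite_red_mons])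
    show "mon m \<in> Sdeg k t" if "m \<in> ?R" for m
      using that by (simp add: red_monsD)
    fix p assume p: "p \<in> Sdeg k t"
    let ?q = "p - (\<Sum>m\<in>?R. cmult (lookup p m) (mon m))"
    have lq: "lookup ?q m = (if m \<in> ?R then 0 else lookup p m)" for m
      by (simp add: lookup_minus lookup_sum_mon[OF finite_red_mons])
    have q: "mono_ok k m \<and> has_square k m" if "m \<in> keys ?q" for m
    proof -
      have "has_mdeg k t m" "m \<notin> ?R"
        using that p by (auto simp: in_keys_iff lq Sdeg_iff split: if_splits)
      then show ?thesis
        using not_red_has_square[of k t m] by (simp add: has_mdeg_def)
    qed
    have "?q \<in> Zk k"
      unfolding Zk_eq square_ideal_def Sring_def using q by blast
    then show "\<exists>c. p - (\<Sum>m\<in>?R. cmult (c m) (mon m)) \<in> Zk k"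
      by (intro exI[of _ "lookup p"])
  qed
  then show "hilb k (Zk k) t \<le> 2 ^ k"
    using card_red_mons[of k t] assms by simp
  have "indep_mod (Zk k) ?R mon"
    unfolding indep_mod_def
  proof (intro allI impI ballI, rule ccontr)
    fix c m
    assume *: "(\<Sum>m\<in>?R. cmult (c m) (mon m)) \<in> Zk k" and m: "m \<in> ?R" "c m \<noteq> 0"
    then have "m \<in> keys (\<Sum>m\<in>?R. cmult (c m) (mon m))"
      by (simp add: in_keys_iff lookup_sum_mon[OF finite_red_mons])
    with * have "has_square k m"
      by (auto simp: Zk_eq square_ideal_def)
    with m(1) not_red_has_square[OF red_monsD(1)[OF m(1)]] show False
      by blast
  qed
  then have "card ?R \<le> hilb k (Zk k) t"
    by (intro indep_card_le_hilb[OF _ finite_red_mons])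
       (auto simp: Zk_eq is_ideal_square_ideal red_monsD)
  then show "2 ^ k \<le> hilb k (Zk k) t"
    using card_red_mons[of k t] assms by simp
qed

section \<open>Degree as the eventual value of the Hilbert function\<close>

lemma scheme_deg_eqI:
  assumes "\<And>t. (\<And>i. i < k \<Longrightarrow> N \<le> t i) \<Longrightarrow> hilb k I t = n"
  shows "scheme_deg k I = n"
  unfolding scheme_deg_def
proof (rule the_equality)
  show "\<exists>N. \<forall>t. (\<forall>i<k. N \<le> t i) \<longrightarrow> hilb k I t = n"
    using assms by blast
  fix n'
  assume "\<exists>N. \<forall>t. (\<forall>i<k. N \<le> t i) \<longrightarrow> hilb k I t = n'"
  then obtain N' where "\<And>t. (\<And>i. i < k \<Longrightarrow> N' \<le> t i) \<Longrightarrow> hilb k I t = n'"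
    by blast
  from this[of "\<lambda>_. max N N'"] assms[of "\<lambda>_. max N N'"] show "n' = n"
    by simp
qed

lemma zero_dim_scheme_Zk: "zero_dim_scheme k (Zk k)"
proof -
  have "multihomogeneous k (Zk k)"
    unfolding multihomogeneous_def Zk_eq square_ideal_def Sring_def
    by (auto simp: in_keys_iff lookup_comp when_def split: if_splits)
  moreover have "\<forall>t. (\<forall>i<k. 1 \<le> t i) \<longrightarrow> hilb k (Zk k) t = 2 ^ k"
    using hilb_Zk by blast
  ultimately show ?thesis
    using is_ideal_square_ideal saturated_square_ideal
    unfolding zero_dim_scheme_def saturated_def Zk_eq by blast
qed

lemma scheme_deg_Zk: "scheme_deg k (Zk k) = 2 ^ k"
  by (rule scheme_deg_eqI[where N = 1]) (rule hilb_Zk)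

text \<open>Raising \<open>t\<close> to the range where the Hilbert function is constant can only
  increase its value.\<close>

lemma hilb_le_scheme_deg:
  assumes "zero_dim_scheme k I"
  shows "hilb k I t \<le> scheme_deg k I"
proof -
  obtain N n where I: "is_ideal k I" "saturated k I"
    and N: "\<And>t. (\<And>i. i < k \<Longrightarrow> N \<le> t i) \<Longrightarrow> hilb k I t = n"
    using assms unfolding zero_dim_scheme_def by blast
  have "hilb k I t \<le> hilb k I (\<lambda>i. max (t i) N)"
    by (rule hilb_mono[OF I]) simp
  also have "\<dots> = n"
    by (rule N) simp
  also have "\<dots> = scheme_deg k I"
    by (rule scheme_deg_eqI[symmetric]) (rule N)
  finally show ?thesis .
qed

subsection \<open>Schemes whose span contains the tensor\<close>

lemma Wtensor_eq: "Wtensor k d = mon (bimono k (\<lambda>i. d i - 1) (\<lambda>_. 1))"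
  by (simp add: Wtensor_def bimono_def)

lemma apolar_mon: "apolar f (mon w) = lookup f w * of_nat (mfact w)"
proof -
  have "apolar f (mon w) = (\<Sum>m\<in>keys f. if m = w then lookup f w * of_nat (mfact w) else 0)"
    unfolding apolar_def by (rule sum.cong) (auto simp: lookup_single when_def)
  then show ?thesis
    by (simp add: in_keys_iff)
qed

lemma mfact_neq_0: "mfact m \<noteq> 0"
  unfolding mfact_def by simp

text \<open>A monomial in \<open>red_mons k t\<close> with \<open>t < d\<close> divides the monomial of the tensor; multiplying
  by the quotient moves its coefficient to the one tested by apolarity.\<close>

lemma lookup_red_mon_eq_0:
  assumes A: "is_ideal k A" "in_span k d A (Wtensor k d)"
    and f: "f \<in> A" "f \<in> Sdeg k t" and m: "m \<in> red_mons k t"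
    and t: "\<And>i. i < k \<Longrightarrow> t i < d i"
  shows "lookup f m = 0"
proof -
  let ?w = "bimono k (\<lambda>i. d i - 1) (\<lambda>_. 1)"
  \<comment> \<open>The quotient of the monomial of the tensor by \<open>m\<close>. The subtractions
    are exact: \<open>t i < d i\<close> bounds the exponent of \<open>X i\<close> by
    \<open>d i - 1\<close>, and that of \<open>Y i\<close> is at most 1.\<close>
  let ?n = "bimono k (\<lambda>i. d i - 1 - lookup m (i, False)) (\<lambda>i. 1 - lookup m (i, True))"
  have mt: "mono_ok k m" "\<And>i. i < k \<Longrightarrow> pdeg m i = t i"
    using red_monsD(1)[OF m] by (simp_all add: has_mdeg_def)
  have w: "?n + m = ?w"
  proof (rule poly_mapping_eqI)
    fix v :: "nat \<times> bool"
    obtain i b where v: "v = (i, b)" by fastforce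
    show "lookup (?n + m) v = lookup ?w v"
    proof (cases "i < k")
      case True
      have "lookup m (i, False) \<le> d i - 1"
        using mt(2)[OF True] t[OF True] by (simp add: pdeg_def)
      then show ?thesis
        using True red_monsD(2)[OF m True] by (cases b) (simp_all add: v lookup_add lookup_bimono)
    next
      case False
      then show ?thesis
        using lookup_mono_ok[OF mt(1) False, of b] by (simp add: v lookup_add lookup_bimono)
    qed
  qed
  have "mon ?n * f \<in> Sdeg k d"
    unfolding Sdeg_def mem_Collect_eq keys_mon_mult
  proof clarify
    fix q assume "q \<in> keys f"
    then have q: "has_mdeg k t q"
      using f(2) by (simp add: Sdeg_def)
    have "pdeg (?n + q) i = d i" if "i < k" for i
    proof -
      have "pdeg (?n + q) i = pdeg (?n + m) i"
        using q mt(2)[OF that] that by (simp add: has_mdeg_def)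
      also have "\<dots> = d i - 1 + 1"
        unfolding w using that by (simp add: pdeg_bimono)
      finally show ?thesis
        using t[OF that] by simp
    qed
    then show "has_mdeg k d (?n + q)"
      using q by (simp add: has_mdeg_def mono_ok_add mono_ok_bimono)
  qed
  moreover have "mon ?n * f \<in> A"
    by (intro is_idealD(4)[OF A(1) f(1)]) (simp add: mono_ok_bimono)
  ultimately have "apolar (mon ?n * f) (mon ?w) = 0"
    using A(2) by (simp add: in_span_def Wtensor_eq)
  then have "lookup (mon ?n * f) (?n + m) = 0"
    unfolding apolar_mon w using mfact_neq_0 by simp
  then show ?thesis
    unfolding lookup_mon_mult .
qed

text \<open>Apolarity makes the standard monomials of multidegree (1,...,1) independent modulo the
  ideal, and the degree bounds the Hilbert function there.\<close>

lemma two_pow_le_scheme_deg: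
  assumes A: "zero_dim_scheme k A" "in_span k d A (Wtensor k d)" and d: "\<And>i. i < k \<Longrightarrow> 3 \<le> d i"
  shows "2 ^ k \<le> scheme_deg k A"
proof -
  let ?R = "red_mons k (\<lambda>_. 1)"
  have I: "is_ideal k A"
    using A(1) by (simp add: zero_dim_scheme_def)
  have S: "mon m \<in> Sdeg k (\<lambda>_. 1)" if "m \<in> ?R" for m
    using that by (simp add: red_monsD)
  have "indep_mod A ?R mon"
    unfolding indep_mod_def
  proof (intro allI impI ballI)
    fix c m
    let ?f = "\<Sum>m\<in>?R. cmult (c m) (mon m)"
    assume f: "?f \<in> A" and m: "m \<in> ?R"
    have "?f \<in> Sdeg k (\<lambda>_. 1)"
      by (intro sum_in_Sdeg cmult_in_Sdeg S)
    then have "lookup ?f m = 0"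
      using lookup_red_mon_eq_0[OF I A(2) f _ m] d by fastforce
    with m show "c m = 0"
      by (simp add: lookup_sum_mon[OF finite_red_mons])
  qed
  then have "card ?R \<le> hilb k A (\<lambda>_. 1)"
    by (intro indep_card_le_hilb[OF I finite_red_mons S])
  also have "\<dots> \<le> scheme_deg k A"
    by (rule hilb_le_scheme_deg[OF A(1)])
  finally show ?thesis
    by (simp add: card_red_mons)
qed

text \<open>The monomial of the tensor contains each \<open>Y i\<close> only once, so it occurs in
  no form of the ideal.\<close>

lemma in_span_Zk: "in_span k d (Zk k) (Wtensor k d)"
  unfolding in_span_def
proof
  fix f
  assume f: "f \<in> Zk k \<inter> Sdeg k d"
  let ?w = "bimono k (\<lambda>i. d i - 1) (\<lambda>_. 1)"
  have "\<not> has_square k ?w"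
    by (simp add: has_square_def lookup_bimono)
  then have "lookup f ?w = 0"
    using f by (auto simp: Zk_eq square_ideal_def in_keys_iff)
  then show "apolar f (Wtensor k d) = 0"
    by (simp add: Wtensor_eq apolar_mon)
qed

lemma cactus_rank_Wtensor:
  assumes "\<And>i. i < k \<Longrightarrow> 3 \<le> d i"
  shows "cactus_rank k d (Wtensor k d) = 2 ^ k"
  unfolding cactus_rank_def
proof (rule Least_equality)
  show "\<exists>I. zero_dim_scheme k I \<and> scheme_deg k I = 2 ^ k \<and> in_span k d I (Wtensor k d)"
    using zero_dim_scheme_Zk scheme_deg_Zk in_span_Zk by blast
  show "2 ^ k \<le> n"
    if "\<exists>I. zero_dim_scheme k I \<and> scheme_deg k I = n \<and> in_span k d I (Wtensor k d)" for n
    using that two_pow_le_scheme_deg assms by blast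
qed

subsection \<open>Uniqueness\<close>

lemma ideal_mon_le:
  assumes "is_ideal k A" "mon m \<in> A" "mono_ok k n" "\<And>v. lookup m v \<le> lookup n v"
  shows "mon n \<in> A"
proof -
  have eq: "m + (n - m) = n"
    by (rule add_diff_mono) (rule assms)
  then have "mono_ok k (n - m)"
    using assms(3) mono_ok_add[of k m "n - m"] by simp
  then have "mon (n - m) * mon m \<in> A"
    by (intro is_idealD(4)[OF assms(1,2)]) simp
  then show ?thesis
    by (simp add: mult_single add.commute eq)
qed

text \<open>Otherwise \<open>n\<close> together with the standard monomials would be an independent
  family of \<open>2 ^ k + 1\<close> elements: in a relation apolarity kills the standard
  coefficients, and a multiple of \<open>mon n\<close> remains.\<close>

lemma nonred_mon_in_ideal:
  assumes A: "zero_dim_scheme k A" "in_span k d A (Wtensor k d)" "scheme_deg k A = 2 ^ k"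
    and n: "has_mdeg k t n" "n \<notin> red_mons k t"
    and t: "\<And>i. i < k \<Longrightarrow> 1 \<le> t i" "\<And>i. i < k \<Longrightarrow> t i < d i"
  shows "mon n \<in> A"
proof (rule ccontr)
  assume notin: "mon n \<notin> A"
  let ?R = "red_mons k t" and ?N = "insert n (red_mons k t)"
  have fin: "finite ?N"
    by (simp add: finite_red_mons)
  have I: "is_ideal k A"
    using A(1) by (simp add: zero_dim_scheme_def)
  have S: "mon m \<in> Sdeg k t" if "m \<in> ?N" for m
    using that n(1) by (auto simp: red_monsD)
  have "indep_mod A ?N mon"
    unfolding indep_mod_def
  proof (intro allI impI)
    fix c
    let ?f = "\<Sum>m\<in>?N. cmult (c m) (mon m)"
    assume f: "?f \<in> A"
    have "?f \<in> Sdeg k t"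
      by (intro sum_in_Sdeg cmult_in_Sdeg S)
    then have "lookup ?f m = 0" if "m \<in> ?R" for m
      using lookup_red_mon_eq_0[OF I A(2) f _ that t(2)] by blast
    then have red: "c m = 0" if "m \<in> ?R" for m
      using that lookup_sum_mon[OF fin, of c m] by simp
    then have "?f = cmult (c n) (mon n)"
      using n(2) by (simp add: finite_red_mons)
    with f have "c n = 0"
      using ideal_cmult_iff[OF I, of "c n" "mon n"] notin by auto
    with red show "\<forall>m\<in>?N. c m = 0"
      by blast
  qed
  then have "card ?N \<le> hilb k A t"
    by (intro indep_card_le_hilb[OF I fin S])
  also have "\<dots> \<le> 2 ^ k"
    using hilb_le_scheme_deg[OF A(1), of t] A(3) by simp
  finally show False
    using n(2) card_red_mons[of k t] t(1) by (simp add: finite_red_mons)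
qed

lemma Zk_subset:
  assumes A: "zero_dim_scheme k A" "in_span k d A (Wtensor k d)" "scheme_deg k A = 2 ^ k"
    and d: "\<And>i. i < k \<Longrightarrow> 3 \<le> d i"
  shows "Zk k \<subseteq> A"
proof
  have I: "is_ideal k A" "saturated k A"
    using A(1) by (simp_all add: zero_dim_scheme_def)
  have Ysq: "mon (Poly_Mapping.single (i, True) 2) \<in> A" if i: "i < k" for i
  proof (rule saturatedI[OF I(2), of _ 1])
    fix m
    assume m: "has_mdeg k (\<lambda>_. 1) m"
    then have "pdeg m i = 1"
      using i by (simp add: has_mdeg_def)
    then obtain b where b: "lookup m (i, b) = 1"
      unfolding pdeg_def by (metis add_is_1 One_nat_def)
    let ?v = "Poly_Mapping.single (i, b) (1::nat)" and ?s = "Poly_Mapping.single (i, True) (2::nat)"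
    \<comment> \<open>The variable of factor \<open>i\<close> in \<open>m\<close> is replaced by the
      square of \<open>Y i\<close>. The result divides \<open>m + ?s\<close>, and its multidegree
      \<open>?t\<close> stays below \<open>d\<close> because \<open>2 < d i\<close>.\<close>
    let ?n = "(m - ?v) + ?s" and ?t = "(\<lambda>_. 1 :: nat)(i := 2)"
    have eq: "?v + (m - ?v) = m"
      using b by (intro add_diff_mono) (auto simp: lookup_single when_def)
    then have ok: "mono_ok k (m - ?v)"
      using m mono_ok_add[of k ?v "m - ?v"] by (simp add: has_mdeg_def)
    have "pdeg ?n j = ?t j" if "j < k" for j
    proof -
      have "pdeg ?v j + pdeg (m - ?v) j = 1"
        using m that pdeg_add[of ?v "m - ?v" j] unfolding eq by (simp add: has_mdeg_def)
      moreover have "pdeg ?v j = (if j = i then 1 else 0)"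
        by (cases b) (simp_all add: pdeg_def lookup_single when_def)
      moreover have "pdeg ?s j = (if j = i then 2 else 0)"
        by (simp add: pdeg_def lookup_single when_def)
      ultimately show ?thesis
        by (simp split: if_splits)
    qed
    then have n: "has_mdeg k ?t ?n"
      using ok i by (simp add: has_mdeg_def mono_ok_add)
    have "has_square k ?n"
      using i by (auto simp: has_square_def lookup_add)
    then have "?n \<notin> red_mons k ?t"
      using not_red_has_square[OF n] by blast
    then have nA: "mon ?n \<in> A"
    proof (rule nonred_mon_in_ideal[OF A n])
      show "1 \<le> ?t j" for j
        by simp
      show "?t j < d j" if "j < k" for j
        using d[OF that] by auto
    qed
    have "mon (m + ?s) \<in> A"
    proof (rule ideal_mon_le[OF I(1) nA])
      show "mono_ok k (m + ?s)"
        using m i by (simp add: has_mdeg_def mono_ok_add)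
      show "lookup ?n v \<le> lookup (m + ?s) v" for v
        by (simp add: lookup_add lookup_minus)
    qed
    then show "mon m * mon ?s \<in> A"
      by (simp add: mult_single)
  qed (use i in simp)
  fix f
  assume f: "f \<in> Zk k"
  have "mon m \<in> A" if m: "m \<in> keys f" for m
  proof -
    obtain i where i: "i < k" "2 \<le> lookup m (i, True)"
      using f m by (auto simp: Zk_eq square_ideal_def has_square_def)
    have "mono_ok k m"
      using f m by (auto simp: Zk_eq square_ideal_def Sring_def)
    then show ?thesis
      using i by (intro ideal_mon_le[OF I(1) Ysq[OF i(1)]]) (auto simp: lookup_single when_def)
  qed
  then have "(\<Sum>m\<in>keys f. cmult (lookup f m) (mon m)) \<in> A"
    by (intro ideal_sum[OF I(1)] ideal_cmult[OF I(1)])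
  then show "f \<in> A"
    by (simp only: poly_as_sum[of f, symmetric])
qed

text \<open>Modulo the squares, a monomial of large multidegree times the product \<open>y\<close> of all \<open>Y\<^sub>i\<close> is
  either 0 or divisible by the given one, so saturation would put \<open>y\<close> into the ideal.\<close>

lemma bimono_1_notin:
  assumes A: "zero_dim_scheme k A" "in_span k d A (Wtensor k d)" "Zk k \<subseteq> A"
    and d: "\<And>i. i < k \<Longrightarrow> 3 \<le> d i"
  shows "mon (bimono k a (\<lambda>_. 1)) \<notin> A"
proof
  assume a: "mon (bimono k a (\<lambda>_. 1)) \<in> A"
  have I: "is_ideal k A" "saturated k A"
    using A(1) by (simp_all add: zero_dim_scheme_def)
  let ?y = "bimono k (\<lambda>_. 0) (\<lambda>_. 1)"
  \<comment> \<open>The multidegree \<open>sum a {..<k}\<close> is at least every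
    \<open>a i\<close>, so a monomial \<open>r\<close> of this multidegree without any
    \<open>Y i\<close> is divisible by all the required powers of the \<open>X i\<close>.\<close>
  have "mon ?y \<in> A"
  proof (rule saturatedI[OF I(2), of _ "sum a {..<k}"])
    fix r
    assume r: "has_mdeg k (\<lambda>_. sum a {..<k}) r"
    then have ok: "mono_ok k (r + ?y)"
      by (simp add: has_mdeg_def mono_ok_add mono_ok_bimono)
    have "mon (r + ?y) \<in> A"
    proof (cases "has_square k (r + ?y)")
      case True
      then have "mon (r + ?y) \<in> Zk k"
        using ok by (simp add: Zk_eq square_ideal_def)
      then show ?thesis
        using A(3) by blast
    next
      case False
      show ?thesis
      proof (rule ideal_mon_le[OF I(1) a ok])
        fix v :: "nat \<times> bool"
        obtain i b where v: "v = (i, b)" by fastforce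
        show "lookup (bimono k a (\<lambda>_. 1)) v \<le> lookup (r + ?y) v"
        proof (cases "i < k")
          case True
          then have "lookup r (i, True) = 0"
            using False by (auto simp: has_square_def lookup_add lookup_bimono)
          moreover have "pdeg r i = sum a {..<k}"
            using r True by (simp add: has_mdeg_def)
          moreover have "a i \<le> sum a {..<k}"
            using True by (intro member_le_sum) auto
          ultimately show ?thesis
            using True by (simp add: v lookup_add lookup_bimono pdeg_def)
        qed (simp add: v lookup_bimono)
      qed
    qed
    then show "mon r * mon ?y \<in> A"
      by (simp add: mult_single)
  qed (simp add: mono_ok_bimono)
  moreover have m: "?y \<in> red_mons k (\<lambda>_. 1)"
    by (simp add: red_mons_def has_mdeg_def mono_ok_bimono pdeg_bimono lookup_bimono)
  moreover have "mon ?y \<in> Sdeg k (\<lambda>_. 1)"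
    using red_monsD(1)[OF m] by (simp only: mon_in_Sdeg)
  moreover have "1 < d i" if "i < k" for i
    using d[OF that] by simp
  ultimately have "lookup (mon ?y) ?y = 0"
    by (intro lookup_red_mon_eq_0[OF I(1) A(2)])
  then show False
    by simp
qed

text \<open>From an element outside \<open>Zk k\<close> a single monomial containing every
  \<open>Y i\<close> exactly once is isolated in \<open>A\<close>, contrary to
  \<open>bimono_1_notin\<close>. Multiplication by suitable \<open>Y i\<close> gives all other
  monomials a square, so they can be removed modulo \<open>Zk k\<close>.\<close>

lemma subset_Zk:
  assumes A: "zero_dim_scheme k A" "in_span k d A (Wtensor k d)" "Zk k \<subseteq> A"
    and d: "\<And>i. i < k \<Longrightarrow> 3 \<le> d i"
  shows "A \<subseteq> Zk k"
proof (rule subsetI, rule ccontr)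
  fix f
  assume fA: "f \<in> A" and "f \<notin> Zk k"
  have I: "is_ideal k A" and mh: "\<And>p t. p \<in> A \<Longrightarrow> comp k t p \<in> A"
    using A(1) unfolding zero_dim_scheme_def multihomogeneous_def by blast+
  have fS: "f \<in> Sring k"
    using fA is_idealD(1)[OF I] by blast
  then obtain m0 where m0: "m0 \<in> keys f" "\<not> has_square k m0"
    using \<open>f \<notin> Zk k\<close> by (auto simp: Zk_eq square_ideal_def)
  \<comment> \<open>In a single multidegree the exponents of the \<open>Y i\<close> determine the
    monomial.\<close>
  define t where "t = pdeg m0"
  define g where "g = comp k t f"
  have gA: "g \<in> A" and gS: "g \<in> Sdeg k t"
    using fA by (simp_all add: g_def mh comp_in_Sdeg)
  have "has_mdeg k t m0"
    using fS m0(1) by (simp add: t_def has_mdeg_pdeg Sring_def)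
  with m0 have "m0 \<in> keys g \<and> \<not> has_square k m0"
    by (simp add: g_def in_keys_iff lookup_comp)
  then obtain m where m: "m \<in> keys g" "\<not> has_square k m"
    and least: "\<And>n. n \<in> keys g \<Longrightarrow> \<not> has_square k n
      \<Longrightarrow> (\<Sum>i<k. lookup m (i, True)) \<le> (\<Sum>i<k. lookup n (i, True))"
    using ex_has_least_nat[of "\<lambda>n. n \<in> keys g \<and> \<not> has_square k n" m0
        "\<lambda>n. \<Sum>i<k. lookup n (i, True)"] by blast
  have gt: "has_mdeg k t n" if "n \<in> keys g" for n
    using gS that by (simp add: Sdeg_def)
  \<comment> \<open>The product of the \<open>Y i\<close> missing from \<open>m\<close>, which has
    the fewest \<open>Y i\<close> among the square-free monomials of \<open>g\<close>.\<close>
  let ?u = "bimono k (\<lambda>_. 0) (\<lambda>i. 1 - lookup m (i, True))"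
  have m1: "lookup m (i, True) \<le> 1" if "i < k" for i
    using m(2) that by (force simp: has_square_def)
  have um: "?u + m = bimono k (\<lambda>i. lookup m (i, False)) (\<lambda>_. 1)"
  proof (rule poly_mapping_eqI)
    fix v :: "nat \<times> bool"
    obtain i b where v: "v = (i, b)" by fastforce
    have "mono_ok k m"
      using gt[OF m(1)] by (simp add: has_mdeg_def)
    then show "lookup (?u + m) v = lookup (bimono k (\<lambda>i. lookup m (i, False)) (\<lambda>_. 1)) v"
      using m1[of i] lookup_mono_ok[of k m i b] by (auto simp: v lookup_add lookup_bimono)
  qed
  \<comment> \<open>If no square arises, \<open>n\<close> contains only \<open>Y i\<close> that
    occur in \<open>m\<close>; by minimality it contains all of them, and equal multidegree forces
    \<open>n = m\<close>.\<close>
  have sq: "has_square k (?u + n)" if n: "n \<in> keys g" "n \<noteq> m" for n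
  proof (rule ccontr)
    assume nsq: "\<not> has_square k (?u + n)"
    then have nsq': "\<not> has_square k n"
      using has_square_add by blast
    have le: "lookup n (i, True) \<le> lookup m (i, True)" if "i < k" for i
    proof -
      have "1 - lookup m (i, True) + lookup n (i, True) \<le> 1"
        using nsq that by (force simp: has_square_def lookup_add lookup_bimono)
      then show ?thesis
        using m1[OF that] by linarith
    qed
    have "lookup n (i, True) = lookup m (i, True)" if "i < k" for i
    proof (rule ccontr)
      assume "lookup n (i, True) \<noteq> lookup m (i, True)"
      then have "(\<Sum>i<k. lookup n (i, True)) < (\<Sum>i<k. lookup m (i, True))"
        using le that by (intro sum_strict_mono_ex1) (auto simp: order_less_le)
      with least[OF n(1) nsq'] show False
        by simp
    qed
    then have "n = m"
      by (intro has_mdeg_eqI[OF gt[OF n(1)] gt[OF m(1)]])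
    with n(2) show False ..
  qed
  let ?c = "lookup g m"
  let ?h = "mon ?u * g - cmult ?c (mon (?u + m))"
  have h: "has_square k q \<and> mono_ok k q" if "q \<in> keys ?h" for q
  proof -
    have "lookup ?h (?u + m) = 0"
      by (simp add: lookup_minus lookup_mon_mult)
    then have "q \<noteq> ?u + m"
      using that by (auto simp: in_keys_iff)
    then have "q \<in> keys (mon ?u * g)"
      using that by (auto simp: in_keys_iff lookup_minus lookup_single)
    then obtain n where n: "n \<in> keys g" "q = ?u + n"
      by (auto simp: keys_mon_mult)
    with \<open>q \<noteq> ?u + m\<close> sq gt show ?thesis
      by (auto simp: mono_ok_add mono_ok_bimono has_mdeg_def)
  qed
  then have "?h \<in> Zk k"
    unfolding Zk_eq square_ideal_def Sring_def by blast
  then have "?h \<in> A"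
    using A(3) by blast
  moreover have "mon ?u * g \<in> A"
    by (intro is_idealD(4)[OF I gA]) (simp add: mono_ok_bimono)
  ultimately have "mon ?u * g - ?h \<in> A"
    using ideal_diff[OF I] by blast
  then have "mon (?u + m) \<in> A"
    using m(1) by (simp add: ideal_cmult_iff[OF I] in_keys_iff)
  then show False
    using bimono_1_notin[OF A d] unfolding um by blast
qed

theorem theorem5p1:
  fixes k :: nat and d :: "nat \<Rightarrow> nat"
  assumes "k \<ge> 1" and "\<forall>i<k. d i \<ge> 3"
  shows "zero_dim_scheme k (Zk k)
       \<and> scheme_deg k (Zk k) = cactus_rank k d (Wtensor k d)
       \<and> in_span k d (Zk k) (Wtensor k d)
       \<and> (\<forall>A. zero_dim_scheme k A \<and> scheme_deg k A = cactus_rank k d (Wtensor k d)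
              \<and> in_span k d A (Wtensor k d) \<longrightarrow> A = Zk k)"
proof -
  have d: "\<And>i. i < k \<Longrightarrow> 3 \<le> d i"
    using assms(2) by blast
  have rank: "cactus_rank k d (Wtensor k d) = 2 ^ k"
    by (rule cactus_rank_Wtensor[OF d])
  have "A = Zk k"
    if A: "zero_dim_scheme k A" "in_span k d A (Wtensor k d)" "scheme_deg k A = 2 ^ k" for A
    using subset_Zk[OF A(1,2) _ d] Zk_subset[OF A d] by blast
  then show ?thesis
    unfolding rank using zero_dim_scheme_Zk scheme_deg_Zk in_span_Zk by blast
qed

end
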